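(* Let $(X,\|\cdot,\cdot\|_{q,\beta},\kappa)$ be a quasi-$(2,\beta)$-Banach space, $0<\beta\le1$, and let $a,b,c,d\in\mathbb{R}\setminus\{0\}$ be fixed numbers. Let $h_i:\mathbb{R}\times X\to\mathbb{R}_+$ be a given function for $i\in\{1,2,3,4\}$, and let $$\mathcal{M}_0:=\big\{n\in\mathbb{N}_2\mid P_n:=\max\{A_n,B_n,C_n\}<1\big\}\neq\emptyset,$$ where $$A_n=\kappa|c|^{\beta}s_1(u_n^3)s_2(u_n^3)+\kappa^2|d|^{\beta}s_1(v_n^3)s_2(v_n^3)+\kappa^2s_1(w_n^3)s_2(w_n^3),$$ $$B_n=\kappa|c|^{\beta}s_3(u_n^3)+\kappa^2|d|^{\beta}s_3(v_n^3)+\kappa^2s_3(w_n^3),$$ $$C_n=\kappa|c|^{\beta}s_4(u_n^3)+\kappa^2|d|^{\beta}s_4(v_n^3)+\kappa^2s_4(w_n^3),$$ $$u_n=\frac{n}{\sqrt[3]{a}},\qquad v_n=\sqrt[3]{\frac{1-n^3}{b}},\qquad w_n=\sqrt[3]{2n^3-1},$$ $$\lim_{n\to\infty}\max\{s_1(u_n^3)s_2(v_n^3),\,s_3(u_n^3),\,s_4(v_n^3)\}=0,$$ and $$s_i(\rho):=\inf\big\{t\in\mathbb{R}_+:\ h_i(\rho x^3,z)\le t\,h_i(x^3,z)\ \text{for all }(x,z)\in\mathbb{R}\times X\big\}$$ for $\rho\in\mathbb{R}_0$ and $i\in\{1,2,3,4\}$, such that one of the following conditions holds: (i) $\lim_{|\rho|\to+\infty}s_1(\rho)s_2(\rho)=0$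 if $P_n=A_n$; (ii) $\lim_{|\rho|\to+\infty}s_3(\rho)=0$ if $P_n=B_n$; (iii) $\lim_{|\rho|\to+\infty}s_4(\rho)=0$ if $P_n=C_n$. If $f:\mathbb{R}\to X$ satisfies $$\Big\|f\big(\sqrt[3]{ax^3+by^3}\big)+f\big(\sqrt[3]{ax^3-by^3}\big)-cf(x)-df(y),z\Big\|_{q,\beta}\le h_1(x^3,z)h_2(y^3,z)+h_3(x^3,z)+h_4(y^3,z)$$ for all $(x,y,z)\in\mathbb{R}_0^2\times X$ with $\sqrt[3]{a}\,x\neq\pm\sqrt[3]{b}\,y$, then $$f\big(\sqrt[3]{ax^3+by^3}\big)+f\big(\sqrt[3]{ax^3-by^3}\big)=cf(x)+df(y)$$ for all $x,y\in\mathbb{R}_0$ with $\sqrt[3]{a}\,x\neq\pm\sqrt[3]{b}\,y$.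
   Context: $\mathbb{N}$ is the set of positive integers, $\mathbb{R}_0=\mathbb{R}\setminus\{0\}$, $\mathbb{R}_+=[0,\infty)$, $\mathbb{N}_2=\{m\in\mathbb{N}: m\ge2\}$, $\mathbb{K}$ is $\mathbb{R}$ or $\mathbb{C}$; $\sqrt[3]{\cdot}$ is the real cube root. Quasi-$(2,\beta)$-normed space: let $0<\beta\le1$ and let $X$ be a linear space over $\mathbb{K}$ with $\dim X\ge2$. A function $\|\cdot,\cdot\|_{q,\beta}:X\times X\to\mathbb{R}_+$ is a quasi-$(2,\beta)$-norm if (B1) $\|x,y\|_{q,\beta}=0$ iff $\{x,y\}$ is linearly dependent; (B2) $\|x,y\|_{q,\beta}=\|y,x\|_{q,\beta}$ for all $x,y\in X$; (B3) $\|\lambda x,y\|_{q,\beta}=|\lambda|^{\beta}\|x,y\|_{q,\beta}$ for all $x,y\in X$ and $\lambda\in\mathbb{K}$; (B4) there is a constant $\kappa\ge1$ with $\|x,y+z\|_{q,\beta}\le\kappa(\|x,y\|_{q,\beta}+\|x,z\|_{q,\beta})$ for all $x,y,z\in X$. The smallest possible $\kappa$ is the modulus of concavity, and $(X,\|\cdot,\cdot\|_{q,\beta},\kappa)$ is called a quasi-$(2,\beta)$-normed space. A sequence $\{x_n\}$ in $X$ is Cauchy if there are two linearly independent points $y,z\in X$ with $\lim_{m,n\to\infty}\|x_m-x_n,y\|_{q,\beta}=0=\lim_{m,n\to\infty}\|x_m-x_n,z\|_{q,\beta}$. It is convergent if there is $x\in X$ with $\lim_{n\to\infty}\|x_n-x,y\|_{q,\beta}=0$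 for all $y\in X$. A quasi-$(2,\beta)$-Banach space is a quasi-$(2,\beta)$-normed space in which every Cauchy sequence is convergent. *)

theory Defs
  imports "HOL-Analysis.Analysis"
begin

text \<open>
  Linear dependence of the pair \<open>x, y\<close> as a family: \<open>x, x\<close> is always dependent. (The library's
  \<^const>\<open>module.dependent\<close> applied to the set \<open>{x, x} = {x}\<close> would not give this.)
\<close>

definition pair_dependent :: "('k::field \<Rightarrow> 'x::ab_group_add \<Rightarrow> 'x) \<Rightarrow> 'x \<Rightarrow> 'x \<Rightarrow> bool" where
  "pair_dependent smul x y \<longleftrightarrow> (\<exists>s t. (s \<noteq> 0 \<or> t \<noteq> 0) \<and> smul s x + smul t y = 0)"

definition concavity_constant :: "('x::ab_group_add \<Rightarrow> 'x \<Rightarrow> real) \<Rightarrow> real \<Rightarrow> bool" where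
  "concavity_constant q k \<longleftrightarrow> 1 \<le> k \<and> (\<forall>x y z. q x (y + z) \<le> k * (q x y + q x z))"

text \<open>
  The scalar field is a type of class \<^class>\<open>real_normed_field\<close>. Both \<^typ>\<open>real\<close> and \<^typ>\<open>complex\<close> are
  instances, and by the Gelfand--Mazur theorem they are the only ones up to isometric isomorphism.
  The assumption \<open>dim_ge_2\<close> is stated through an independent pair because
  \<^const>\<open>vector_space.dim\<close> is finite-valued and does not describe infinite-dimensional spaces.
  The parameter \<open>\<kappa>\<close> is the modulus of concavity, i.e. the least constant.
\<close>

locale quasi_2_beta_normed_space = vector_space smul
  for smul :: "'k::real_normed_field \<Rightarrow> 'x::ab_group_add \<Rightarrow> 'x" +
  fixes q :: "'x \<Rightarrow> 'x \<Rightarrow> real" and \<beta> \<kappa> :: real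
  assumes beta_pos: "0 < \<beta>" and beta_le_1: "\<beta> \<le> 1"
    and dim_ge_2: "\<exists>x y. \<not> pair_dependent smul x y"
    and q_nonneg: "0 \<le> q x y"
    and q_eq_0_iff: "q x y = 0 \<longleftrightarrow> pair_dependent smul x y"
    and q_sym: "q x y = q y x"
    and q_scale: "q (smul l x) y = norm l powr \<beta> * q x y"
    and kappa_concavity: "concavity_constant q \<kappa>"
    and kappa_least: "concavity_constant q k \<Longrightarrow> \<kappa> \<le> k"
begin

definition q_Cauchy :: "(nat \<Rightarrow> 'x) \<Rightarrow> bool" where
  "q_Cauchy X \<longleftrightarrow> (\<exists>y z. \<not> pair_dependent smul y z
      \<and> ((\<lambda>(m, n). q (X m - X n) y) \<longlongrightarrow> 0) (sequentially \<times>\<^sub>F sequentially)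
      \<and> ((\<lambda>(m, n). q (X m - X n) z) \<longlongrightarrow> 0) (sequentially \<times>\<^sub>F sequentially))"

definition q_convergent :: "(nat \<Rightarrow> 'x) \<Rightarrow> bool" where
  "q_convergent X \<longleftrightarrow> (\<exists>x. \<forall>y. (\<lambda>n. q (X n - x) y) \<longlonglongrightarrow> 0)"

end

locale quasi_2_beta_Banach_space = quasi_2_beta_normed_space +
  assumes q_complete: "q_Cauchy X \<Longrightarrow> q_convergent X"

text \<open>
  The infimum \<open>s(\<rho>)\<close> is taken in \<open>[0, \<infinity>]\<close>, so that it is \<open>\<infinity>\<close> if no admissible \<open>t\<close> exists.
  The product \<open>0 \<cdot> \<infinity>\<close> is \<open>0\<close> in \<^typ>\<open>ennreal\<close>; it matters only where the function \<open>h\<close> of the factor \<open>0\<close>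
  is identically \<open>0\<close>.
\<close>

definition dil :: "(real \<Rightarrow> 'x \<Rightarrow> real) \<Rightarrow> real \<Rightarrow> ennreal" where
  "dil h \<rho> = Inf (ennreal ` {t. 0 \<le> t \<and> (\<forall>x z. h (\<rho> * x ^ 3) z \<le> t * h (x ^ 3) z)})"

text \<open>\<^term>\<open>root 3\<close> is the real cube root, also for negative arguments.\<close>

definition u_seq :: "real \<Rightarrow> nat \<Rightarrow> real" where
  "u_seq a n = real n / root 3 a"

definition v_seq :: "real \<Rightarrow> nat \<Rightarrow> real" where
  "v_seq b n = root 3 ((1 - real n ^ 3) / b)"

definition w_seq :: "nat \<Rightarrow> real" where
  "w_seq n = root 3 (2 * real n ^ 3 - 1)"

text \<open>
  The common shape of \<open>A\<^sub>n\<close>, \<open>B\<^sub>n\<close>, \<open>C\<^sub>n\<close>: these are the cases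
  \<open>\<sigma> = s\<^sub>1 s\<^sub>2\<close>, \<open>\<sigma> = s\<^sub>3\<close>, \<open>\<sigma> = s\<^sub>4\<close>.
\<close>

definition dil_coeff ::
    "real \<Rightarrow> real \<Rightarrow> real \<Rightarrow> real \<Rightarrow> real \<Rightarrow> real \<Rightarrow> (real \<Rightarrow> ennreal) \<Rightarrow> nat \<Rightarrow> ennreal" where
  "dil_coeff \<kappa> \<beta> a b c d \<sigma> n =
      ennreal (\<kappa> * \<bar>c\<bar> powr \<beta>) * \<sigma> (u_seq a n ^ 3)
    + ennreal (\<kappa>\<^sup>2 * \<bar>d\<bar> powr \<beta>) * \<sigma> (v_seq b n ^ 3)
    + ennreal (\<kappa>\<^sup>2) * \<sigma> (w_seq n ^ 3)"

end

theory Submission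
  imports Defs
begin

text \<open>
  Put \<open>g t = f (root 3 t)\<close> and let \<open>D X Y = g (a X + b Y) + g (a X - b Y) - c g X - d g Y\<close> be the
  defect of the equation. With \<open>U = n\<^sup>3 / a\<close>, \<open>V = (1 - n\<^sup>3) / b\<close>, \<open>W = 2 n\<^sup>3 - 1\<close> one has
  \<open>D (U T) (V T) = g T + g (W T) - c g (U T) - d g (V T)\<close>. Substituting this expression for \<open>g T\<close> at
  the four points occurring in \<open>D X Y\<close> writes \<open>D X Y\<close> as a linear combination of
  \<open>D (U T) (V T)\<close>, where \<open>T\<close> is one of \<open>a X + b Y\<close>, \<open>a X - b Y\<close>, \<open>X\<close>, \<open>Y\<close>, and of
  \<open>D (U X) (U Y)\<close>, \<open>D (V X) (V Y)\<close>, \<open>D (W X) (W Y)\<close>. As \<open>n \<rightarrow> \<infinity>\<close> the former vanish by the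
  assumption on the maximum, the latter because the case conditions force \<open>P\<^sub>n \<rightarrow> 0\<close>. Hence
  \<open>D X Y = 0\<close>.
\<close>

section \<open>Null limits and separation of points in a quasi-(2,\<beta>)-normed space\<close>

context quasi_2_beta_normed_space
begin

lemma q_add_left_le: "q (x + y) z \<le> \<kappa> * (q x z + q y z)"
  using kappa_concavity q_sym unfolding concavity_constant_def by metis

lemma tendsto_q_add:
  assumes "((\<lambda>i. q (X i) z) \<longlongrightarrow> 0) F" "((\<lambda>i. q (Y i) z) \<longlongrightarrow> 0) F"
  shows "((\<lambda>i. q (X i + Y i) z) \<longlongrightarrow> 0) F"
proof (rule tendsto_sandwich[OF _ _ tendsto_const])
  show "((\<lambda>i. \<kappa> * (q (X i) z + q (Y i) z)) \<longlongrightarrow> 0) F"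
    using tendsto_mult_left[OF tendsto_add[OF assms], of \<kappa>] by simp
qed (auto simp: q_nonneg q_add_left_le)

lemma tendsto_q_scale:
  assumes "((\<lambda>i. q (X i) z) \<longlongrightarrow> 0) F"
  shows "((\<lambda>i. q (smul l (X i)) z) \<longlongrightarrow> 0) F"
  using tendsto_mult_left[OF assms, of "norm l powr \<beta>"] by (simp add: q_scale)

lemma tendsto_q_diff:
  assumes "((\<lambda>i. q (X i) z) \<longlongrightarrow> 0) F" "((\<lambda>i. q (Y i) z) \<longlongrightarrow> 0) F"
  shows "((\<lambda>i. q (X i - Y i) z) \<longlongrightarrow> 0) F"
  using tendsto_q_add[OF assms(1) tendsto_q_scale[OF assms(2), of "-1"]] by simp

lemma pair_dependent_imp_scaled:
  assumes "pair_dependent smul x y" "x \<noteq> 0"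
  obtains l where "y = smul l x"
proof -
  obtain s t where st: "s \<noteq> 0 \<or> t \<noteq> 0" "smul s x + smul t y = 0"
    using assms(1) unfolding pair_dependent_def by blast
  have "t \<noteq> 0"
    using st assms(2) by auto
  moreover have "smul t y = smul (- s) x"
    using st(2) by (simp add: add_eq_0_iff)
  ultimately have "y = smul (inverse t * - s) x"
    by (metis left_inverse scale_one scale_scale)
  then show thesis ..
qed

text \<open>A nonzero \<open>x\<close> dependent with every vector would make every vector a
  multiple of \<open>x\<close>, against \<open>dim_ge_2\<close>.\<close>

lemma eq_0_if_q_eq_0:
  assumes "\<And>z. q x z = 0"
  shows "x = 0"
proof (rule ccontr)
  assume "x \<noteq> 0"
  obtain y z where indep: "\<not> pair_dependent smul y z"
    using dim_ge_2 by blast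
  have dep: "pair_dependent smul x w" for w
    using assms q_eq_0_iff by blast
  obtain k l where kl: "y = smul k x" "z = smul l x"
    using pair_dependent_imp_scaled[OF dep \<open>x \<noteq> 0\<close>] by metis
  have "pair_dependent smul y z"
  \<comment> \<open>The relation \<open>smul (- l) y + smul k z = 0\<close> is sure to be nontrivial
    only if \<open>k\<close> is nonzero; otherwise \<open>y = 0\<close> gives a relation by
    itself.\<close>
  proof (cases "k = 0")
    case True
    then show ?thesis
      unfolding pair_dependent_def kl by (intro exI[of _ 1] exI[of _ 0]) simp
  next
    case False
    then show ?thesis
      unfolding pair_dependent_def kl by (intro exI[of _ "- l"] exI[of _ k]) (simp add: mult.commute)
  qed
  with indep show False ..
qed

end

section \<open>Bounds and limits obtained from the dilation constants\<close>

lemma power3_root3 [simp]: "root 3 x ^ 3 = x"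
  by (simp add: odd_real_root_pow)

text \<open>Every real is a cube, so an admissible \<open>t\<close> works at all points. Where
  \<open>h x z\<close> is positive, the quotient \<open>h (\<rho> * x) z / h x z\<close> is a lower
  bound of the admissible \<open>t\<close>, hence at most their infimum.\<close>

lemma le_dil_mult:
  assumes nonneg: "\<And>t z. 0 \<le> h t z" and fin: "dil h \<rho> < top"
  shows "ennreal (h (\<rho> * x) z) \<le> dil h \<rho> * ennreal (h x z)"
proof -
  let ?S = "{t. 0 \<le> t \<and> (\<forall>x z. h (\<rho> * x ^ 3) z \<le> t * h (x ^ 3) z)}"
  have le: "h (\<rho> * x) z \<le> t * h x z" if "t \<in> ?S" for t
  proof -
    have "h (\<rho> * root 3 x ^ 3) z \<le> t * h (root 3 x ^ 3) z"
      using that by blast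
    then show ?thesis
      by simp
  qed
  obtain t0 where t0: "t0 \<in> ?S"
    using fin unfolding dil_def by (metis (no_types, lifting) Inf_empty empty_iff ex_in_conv image_empty less_irrefl)
  show ?thesis
  proof (cases "h x z = 0")
    \<comment> \<open>Since \<open>top * 0 = 0\<close>, the right side vanishes here whatever
      \<open>dil h \<rho>\<close> is. It takes a real admissible \<open>t0\<close>, supplied by
      finiteness, to make the left side vanish too.\<close>
    case True
    then show ?thesis
      using le[OF t0] nonneg[of "\<rho> * x" z] by simp
  next
    case False
    then have pos: "h x z > 0"
      using nonneg[of x z] by simp
    have "ennreal (h (\<rho> * x) z / h x z) \<le> dil h \<rho>"
      unfolding dil_def
    proof (rule Inf_greatest)
      fix r
      assume "r \<in> ennreal ` ?S"
      then obtain t where t: "t \<in> ?S" "r = ennreal t"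
        by blast
      show "ennreal (h (\<rho> * x) z / h x z) \<le> r"
        unfolding t(2) using le[OF t(1)] pos by (intro ennreal_leI) (simp add: pos_divide_le_eq)
    qed
    then have "ennreal (h (\<rho> * x) z / h x z) * ennreal (h x z) \<le> dil h \<rho> * ennreal (h x z)"
      by (rule mult_right_mono) simp
    then show ?thesis
      using pos nonneg[of "\<rho> * x" z] by (simp flip: ennreal_mult)
  qed
qed

text \<open>Division by the nonzero \<open>\<rho>\<close> shows that every point is a dilated
  one.\<close>

lemma dil_eq_0_imp_eq_0:
  assumes nonneg: "\<And>t z. 0 \<le> h t z" and "dil h \<rho> = 0" "\<rho> \<noteq> 0"
  shows "h x z = 0"
  using le_dil_mult[of h \<rho> "x / \<rho>" z] assms nonneg[of x z] by simp

text \<open>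
  Finiteness of the product does not exclude the factors \<open>0\<close> and \<open>\<infinity>\<close>; in that case one of the two
  functions vanishes identically.
\<close>

lemma le_dil_mult_dil_mult:
  assumes nonneg: "\<And>t z. 0 \<le> h t z" "\<And>t z. 0 \<le> k t z"
    and fin: "dil h \<rho> * dil k \<sigma> < top" and nz: "\<rho> \<noteq> 0" "\<sigma> \<noteq> 0"
  shows "ennreal (h (\<rho> * x) z * k (\<sigma> * y) z) \<le> dil h \<rho> * dil k \<sigma> * ennreal (h x z * k y z)"
proof (cases "dil h \<rho> = 0 \<or> dil k \<sigma> = 0")
  case True
  then have "h (\<rho> * x) z * k (\<sigma> * y) z = 0"
    using dil_eq_0_imp_eq_0 nonneg nz by (metis mult_eq_0_iff)
  then show ?thesis
    by (simp only: ennreal_0 zero_le)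
next
  case False
  then have "dil h \<rho> < top" "dil k \<sigma> < top"
    using fin by (auto simp: ennreal_mult_less_top)
  from mult_mono[OF le_dil_mult[OF nonneg(1) this(1)] le_dil_mult[OF nonneg(2) this(2)], of x z y z]
  show ?thesis
    using nonneg by (simp add: ennreal_mult mult.assoc mult.left_commute)
qed

text \<open>Passes from extended dilation constants to real values: the fixed factor is finite, so
  the product with it still tends to 0.\<close>

lemma tendsto_0_if_eventually_le_mult:
  fixes g :: "'i \<Rightarrow> real" and s :: "'i \<Rightarrow> ennreal"
  assumes s: "(s \<longlongrightarrow> 0) F" and le: "eventually (\<lambda>i. ennreal (g i) \<le> s i * ennreal r) F"
    and nonneg: "\<And>i. 0 \<le> g i"
  shows "(g \<longlongrightarrow> 0) F"
proof -
  have "((\<lambda>i. s i * ennreal r) \<longlongrightarrow> 0) F"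
    using tendsto_mult_ennreal[OF s tendsto_const, of "ennreal r"] by simp
  then have "((\<lambda>i. ennreal (g i)) \<longlongrightarrow> ennreal 0) F"
    using tendsto_sandwich[OF _ le tendsto_const] by simp
  then show ?thesis
    by (rule tendsto_ennrealD) (simp_all add: nonneg)
qed

lemma eventually_less_top_ennreal:
  fixes s :: "'i \<Rightarrow> ennreal"
  assumes "(s \<longlongrightarrow> 0) F"
  shows "eventually (\<lambda>i. s i < top) F"
  using order_tendstoD(2)[OF assms, of top] by simp

text \<open>Convergence to 0 makes the constants eventually finite, as \<open>le_dil_mult\<close>
  requires.\<close>

lemma tendsto_dilated:
  assumes "\<And>t z. 0 \<le> h t z" and lim: "((\<lambda>i. dil h (\<rho> i)) \<longlongrightarrow> 0) F"
  shows "((\<lambda>i. h (\<rho> i * x) z) \<longlongrightarrow> 0) F"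
  using eventually_less_top_ennreal[OF lim]
  by (intro tendsto_0_if_eventually_le_mult[OF lim]) (auto elim!: eventually_mono intro: le_dil_mult assms)

lemma tendsto_dilated_mult_dilated:
  assumes nonneg: "\<And>t z. 0 \<le> h t z" "\<And>t z. 0 \<le> k t z"
    and lim: "((\<lambda>i. dil h (\<rho> i) * dil k (\<sigma> i)) \<longlongrightarrow> 0) F"
    and nz: "eventually (\<lambda>i. \<rho> i \<noteq> 0 \<and> \<sigma> i \<noteq> 0) F"
  shows "((\<lambda>i. h (\<rho> i * x) z * k (\<sigma> i * y) z) \<longlongrightarrow> 0) F"
proof (rule tendsto_0_if_eventually_le_mult[OF lim])
  show "eventually (\<lambda>i. ennreal (h (\<rho> i * x) z * k (\<sigma> i * y) z)
      \<le> dil h (\<rho> i) * dil k (\<sigma> i) * ennreal (h x z * k y z)) F"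
    using eventually_less_top_ennreal[OF lim] nz
    by eventually_elim (auto intro: le_dil_mult_dil_mult nonneg)
qed (use nonneg in auto)

section \<open>The dilation factors and the coefficients formed along them\<close>

lemma filterlim_dilation_factors:
  assumes "a \<noteq> 0" "b \<noteq> 0"
  shows "filterlim (\<lambda>n. u_seq a n ^ 3) at_infinity sequentially"
    and "filterlim (\<lambda>n. v_seq b n ^ 3) at_infinity sequentially"
    and "filterlim (\<lambda>n. w_seq n ^ 3) at_infinity sequentially"
proof -
  have cube: "filterlim (\<lambda>n. real n ^ 3) at_top sequentially"
    by (rule filterlim_pow_at_top) (auto simp: filterlim_real_sequentially)
  \<comment> \<open>The factors \<open>1 / a\<close> and, below, \<open>- 1 / b\<close> may have
    either sign, so only the absolute value is known to grow.\<close>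
  have "filterlim (\<lambda>n. 1 / a * real n ^ 3) at_infinity sequentially"
    using assms
    by (intro tendsto_mult_filterlim_at_infinity[OF tendsto_const _ filterlim_at_top_imp_at_infinity[OF cube]]) auto
  then show "filterlim (\<lambda>n. u_seq a n ^ 3) at_infinity sequentially"
    by (simp add: u_seq_def power_divide)
  have cube': "filterlim (\<lambda>n. - 1 + real n ^ 3) at_top sequentially"
    by (rule filterlim_tendsto_add_at_top[OF tendsto_const cube])
  have "filterlim (\<lambda>n. - 1 / b * (- 1 + real n ^ 3)) at_infinity sequentially"
    using assms
    by (intro tendsto_mult_filterlim_at_infinity[OF tendsto_const _ filterlim_at_top_imp_at_infinity[OF cube']]) auto
  then show "filterlim (\<lambda>n. v_seq b n ^ 3) at_infinity sequentially"
    by (simp add: v_seq_def diff_divide_distrib algebra_simps)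
  have "filterlim (\<lambda>n. - 1 + 2 * real n ^ 3) at_top sequentially"
    by (intro filterlim_tendsto_add_at_top[OF tendsto_const]
        filterlim_tendsto_pos_mult_at_top[OF tendsto_const _ cube]) auto
  then show "filterlim (\<lambda>n. w_seq n ^ 3) at_infinity sequentially"
    by (simp add: w_seq_def filterlim_at_top_imp_at_infinity)
qed

lemma tendsto_ennreal_const_mult_0:
  assumes "(s \<longlongrightarrow> 0) F"
  shows "((\<lambda>i. ennreal r * s i) \<longlongrightarrow> 0) F"
  using tendsto_mult_ennreal[OF tendsto_const[of "ennreal r"] assms] by simp

lemma tendsto_dil_coeff:
  assumes "a \<noteq> 0" "b \<noteq> 0" and lim: "(s \<longlongrightarrow> 0) at_infinity"
  shows "dil_coeff \<kappa> \<beta> a b c d s \<longlonglongrightarrow> 0"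
proof -
  note lims = filterlim_dilation_factors[OF assms(1,2), THEN filterlim_compose[OF lim],
      THEN tendsto_ennreal_const_mult_0]
  have "(\<lambda>n. dil_coeff \<kappa> \<beta> a b c d s n) \<longlonglongrightarrow> 0 + 0 + 0"
    unfolding dil_coeff_def by (intro tendsto_add lims)
  then show ?thesis
    by simp
qed

lemma tendsto_0_if_const_mult_le:
  fixes s S :: "'i \<Rightarrow> ennreal"
  assumes S: "(S \<longlongrightarrow> 0) F" and r: "0 < r" and le: "\<And>i. ennreal r * s i \<le> S i"
  shows "(s \<longlongrightarrow> 0) F"
proof (rule tendsto_sandwich[OF _ _ tendsto_const])
  show "((\<lambda>i. ennreal (1 / r) * S i) \<longlongrightarrow> 0) F"
    by (rule tendsto_ennreal_const_mult_0[OF S])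
  have "s i \<le> ennreal (1 / r) * S i" for i
  proof -
    have "s i = ennreal (1 / r) * (ennreal r * s i)"
      using r by (simp flip: mult.assoc ennreal_mult)
    also have "\<dots> \<le> ennreal (1 / r) * S i"
      by (intro mult_left_mono le) simp
    finally show ?thesis .
  qed
  then show "eventually (\<lambda>i. s i \<le> ennreal (1 / r) * S i) F"
    by simp
qed simp

text \<open>Each summand is at most the whole coefficient, and its constant factor is positive
  because \<kappa> is at least 1 and \<open>c\<close>, \<open>d\<close> are nonzero.\<close>

lemma tendsto_if_tendsto_dil_coeff:
  assumes lim: "dil_coeff \<kappa> \<beta> a b c d s \<longlonglongrightarrow> 0" and "1 \<le> \<kappa>" "c \<noteq> 0" "d \<noteq> 0"
  shows "(\<lambda>n. s (u_seq a n ^ 3)) \<longlonglongrightarrow> 0"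
    and "(\<lambda>n. s (v_seq b n ^ 3)) \<longlonglongrightarrow> 0"
    and "(\<lambda>n. s (w_seq n ^ 3)) \<longlonglongrightarrow> 0"
proof -
  show "(\<lambda>n. s (u_seq a n ^ 3)) \<longlonglongrightarrow> 0"
    by (rule tendsto_0_if_const_mult_le[OF lim, of "\<kappa> * \<bar>c\<bar> powr \<beta>"])
      (use assms in \<open>auto simp: dil_coeff_def add.assoc\<close>)
  show "(\<lambda>n. s (v_seq b n ^ 3)) \<longlonglongrightarrow> 0"
    by (rule tendsto_0_if_const_mult_le[OF lim, of "\<kappa>\<^sup>2 * \<bar>d\<bar> powr \<beta>"])
      (use assms in \<open>auto simp: dil_coeff_def intro: add_increasing add_increasing2\<close>)
  show "(\<lambda>n. s (w_seq n ^ 3)) \<longlonglongrightarrow> 0"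
    by (rule tendsto_0_if_const_mult_le[OF lim, of "\<kappa>\<^sup>2"])
      (use assms in \<open>auto simp: dil_coeff_def intro: add_increasing\<close>)
qed

lemma tendsto_0_le_ennreal:
  fixes s S :: "'i \<Rightarrow> ennreal"
  assumes "(S \<longlongrightarrow> 0) F" "\<And>i. s i \<le> S i"
  shows "(s \<longlongrightarrow> 0) F"
  using tendsto_0_if_const_mult_le[of S F 1 s] assms by simp

text \<open>Cubing is injective on the reals; this moves the side conditions to the variables
  \<open>x ^ 3\<close> and \<open>y ^ 3\<close>.\<close>

lemma root3_mult_eq_iff:
  "root 3 a * x = root 3 b * y \<longleftrightarrow> a * x ^ 3 = b * y ^ 3"
  "root 3 a * x = - (root 3 b * y) \<longleftrightarrow> a * x ^ 3 = - (b * y ^ 3)"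
proof -
  have inj: "s = t \<longleftrightarrow> s ^ 3 = t ^ 3" for s t :: real
    using odd_real_root_power_cancel[of 3] by (metis odd_numeral)
  show "root 3 a * x = root 3 b * y \<longleftrightarrow> a * x ^ 3 = b * y ^ 3"
    by (subst inj) (simp add: power_mult_distrib)
  show "root 3 a * x = - (root 3 b * y) \<longleftrightarrow> a * x ^ 3 = - (b * y ^ 3)"
    by (subst inj) (simp add: power_mult_distrib)
qed

section \<open>Vanishing of the defect of the functional equation\<close>

theorem theorem5p1:
  fixes smul :: "'k::real_normed_field \<Rightarrow> 'x::ab_group_add \<Rightarrow> 'x"
    and q :: "'x \<Rightarrow> 'x \<Rightarrow> real"
    and \<beta> \<kappa> a b c d :: real
    and h\<^sub>1 h\<^sub>2 h\<^sub>3 h\<^sub>4 :: "real \<Rightarrow> 'x \<Rightarrow> real"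
    and s\<^sub>1 s\<^sub>2 s\<^sub>3 s\<^sub>4 :: "real \<Rightarrow> ennreal"
    and A B C P :: "nat \<Rightarrow> ennreal"
    and f :: "real \<Rightarrow> 'x"
  defines "s\<^sub>1 \<equiv> dil h\<^sub>1" and "s\<^sub>2 \<equiv> dil h\<^sub>2" and "s\<^sub>3 \<equiv> dil h\<^sub>3" and "s\<^sub>4 \<equiv> dil h\<^sub>4"
    and "A \<equiv> dil_coeff \<kappa> \<beta> a b c d (\<lambda>\<rho>. s\<^sub>1 \<rho> * s\<^sub>2 \<rho>)"
    and "B \<equiv> dil_coeff \<kappa> \<beta> a b c d s\<^sub>3"
    and "C \<equiv> dil_coeff \<kappa> \<beta> a b c d s\<^sub>4"
    and "P \<equiv> (\<lambda>n. max (A n) (max (B n) (C n)))"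
  assumes Banach: "quasi_2_beta_Banach_space smul q \<beta> \<kappa>"
    and nonzero: "a \<noteq> 0" "b \<noteq> 0" "c \<noteq> 0" "d \<noteq> 0"
    and h_nonneg: "\<And>t z. 0 \<le> h\<^sub>1 t z" "\<And>t z. 0 \<le> h\<^sub>2 t z" "\<And>t z. 0 \<le> h\<^sub>3 t z" "\<And>t z. 0 \<le> h\<^sub>4 t z"
    and M0_nonempty: "{n. 2 \<le> n \<and> P n < 1} \<noteq> {}"
    and lim_max: "(\<lambda>n. max (s\<^sub>1 (u_seq a n ^ 3) * s\<^sub>2 (v_seq b n ^ 3))
                         (max (s\<^sub>3 (u_seq a n ^ 3)) (s\<^sub>4 (v_seq b n ^ 3)))) \<longlonglongrightarrow> 0"
    and cases: "\<forall>n\<ge>2. (P n = A n \<and> ((\<lambda>\<rho>. s\<^sub>1 \<rho> * s\<^sub>2 \<rho>) \<longlongrightarrow> 0) at_infinity)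
                    \<or> (P n = B n \<and> (s\<^sub>3 \<longlongrightarrow> 0) at_infinity)
                    \<or> (P n = C n \<and> (s\<^sub>4 \<longlongrightarrow> 0) at_infinity)"
    and approx: "\<And>x y z. \<lbrakk>x \<noteq> 0; y \<noteq> 0; root 3 a * x \<noteq> root 3 b * y; root 3 a * x \<noteq> - (root 3 b * y)\<rbrakk> \<Longrightarrow>
        q (f (root 3 (a * x ^ 3 + b * y ^ 3)) + f (root 3 (a * x ^ 3 - b * y ^ 3))
             - smul (of_real c) (f x) - smul (of_real d) (f y)) z
          \<le> h\<^sub>1 (x ^ 3) z * h\<^sub>2 (y ^ 3) z + h\<^sub>3 (x ^ 3) z + h\<^sub>4 (y ^ 3) z"
  shows "\<forall>x y. x \<noteq> 0 \<longrightarrow> y \<noteq> 0 \<longrightarrow> root 3 a * x \<noteq> root 3 b * y \<longrightarrow> root 3 a * x \<noteq> - (root 3 b * y) \<longrightarrow>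
      f (root 3 (a * x ^ 3 + b * y ^ 3)) + f (root 3 (a * x ^ 3 - b * y ^ 3))
        = smul (of_real c) (f x) + smul (of_real d) (f y)"
proof (intro allI impI)
  interpret quasi_2_beta_Banach_space smul q \<beta> \<kappa>
    by (rule Banach)
  fix x y :: real
  assume xy: "x \<noteq> 0" "y \<noteq> 0" "root 3 a * x \<noteq> root 3 b * y" "root 3 a * x \<noteq> - (root 3 b * y)"
  define g where "g t = f (root 3 t)" for t
  define D where "D X Y = g (a * X + b * Y) + g (a * X - b * Y)
      - smul (of_real c) (g X) - smul (of_real d) (g Y)" for X Y
  define U V W where "U n = u_seq a n ^ 3" and "V n = v_seq b n ^ 3" and "W n = w_seq n ^ 3" for n
  have U: "U n = real n ^ 3 / a" and V: "V n = (1 - real n ^ 3) / b" and W: "W n = 2 * real n ^ 3 - 1"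
    for n
    by (simp_all add: U_def V_def W_def u_seq_def v_seq_def w_seq_def power_divide)
  have aU: "a * (U n * T) = real n ^ 3 * T" and bV: "b * (V n * T) = (1 - real n ^ 3) * T" for n T
    using nonzero by (simp_all add: U V)
  have cube_gt_1: "real n ^ 3 > 1" if "n \<ge> 2" for n
    using that by (simp add: one_less_power)
  have ev: "eventually (\<lambda>n. U n \<noteq> 0 \<and> V n \<noteq> 0 \<and> W n \<noteq> 0) sequentially"
    \<comment> \<open>Starting at 2 excludes \<open>U 0 = 0\<close> and
      \<open>V 1 = 0\<close>.\<close>
    using eventually_ge_at_top[of 2]
  proof eventually_elim
    case (elim n)
    have "real n ^ 3 \<noteq> 0" "1 - real n ^ 3 \<noteq> 0" "2 * real n ^ 3 - 1 \<noteq> 0"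
      using cube_gt_1[OF elim] by linarith+
    then show ?case
      using nonzero by (simp only: U V W divide_eq_0_iff not_False_eq_True simp_thms)
  qed
  have kappa: "1 \<le> \<kappa>"
    using kappa_concavity by (simp add: concavity_constant_def)

  have D_le: "q (D X Y) z \<le> h\<^sub>1 X z * h\<^sub>2 Y z + h\<^sub>3 X z + h\<^sub>4 Y z"
    if "X \<noteq> 0" "Y \<noteq> 0" "a * X \<noteq> b * Y" "a * X \<noteq> - (b * Y)" for X Y z
    using approx[of "root 3 X" "root 3 Y" z] that by (simp add: root3_mult_eq_iff D_def g_def)

  have P_lim: "P \<longlonglongrightarrow> 0"
  proof (rule order_tendstoI)
    fix e :: ennreal
    assume "0 < e"
    \<comment> \<open>The case that applies may change with \<open>n\<close>. The implication
      therefore stands inside \<open>eventually\<close>: on the common tail of its three instances,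
      the case valid at \<open>n\<close> bounds \<open>P n\<close>.\<close>
    have *: "eventually (\<lambda>n. (s \<longlongrightarrow> 0) at_infinity \<longrightarrow> dil_coeff \<kappa> \<beta> a b c d s n < e) sequentially" for s
    proof (cases "(s \<longlongrightarrow> 0) at_infinity")
      case True
      then show ?thesis
        using order_tendstoD(2)[OF tendsto_dil_coeff \<open>0 < e\<close>] nonzero by simp
    qed simp
    show "eventually (\<lambda>n. P n < e) sequentially"
      using *[of "\<lambda>\<rho>. s\<^sub>1 \<rho> * s\<^sub>2 \<rho>"] *[of s\<^sub>3] *[of s\<^sub>4] eventually_ge_at_top[of 2]
    proof eventually_elim
      case (elim n)
      then show ?case
        using cases unfolding A_def B_def C_def by metis
    qed
  qed simp
  \<comment> \<open>All three lie below \<open>P\<close>, so every dilation constant vanishes along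
    \<open>U\<close>, \<open>V\<close>, \<open>W\<close>, also where no case gives its limit at
    infinity.\<close>
  have "A \<longlonglongrightarrow> 0" "B \<longlonglongrightarrow> 0" "C \<longlonglongrightarrow> 0"
    by (auto intro!: tendsto_0_le_ennreal[OF P_lim] simp: P_def le_max_iff_disj)
  note coeff_lims = this[unfolded A_def B_def C_def, THEN tendsto_if_tendsto_dil_coeff(1)]
    this[unfolded A_def B_def C_def, THEN tendsto_if_tendsto_dil_coeff(2)]
    this[unfolded A_def B_def C_def, THEN tendsto_if_tendsto_dil_coeff(3)]
  note coeff_lims = coeff_lims[OF kappa nonzero(3,4), folded U_def V_def W_def]

  \<comment> \<open>Separate multipliers cover both later uses: the pair \<open>U\<close>,
    \<open>V\<close> at one point, and a single multiplier at two points.\<close>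
  have D_lim: "(\<lambda>n. q (D (\<rho> n * X) (\<sigma> n * Y)) z) \<longlonglongrightarrow> 0"
    if nz: "eventually (\<lambda>n. \<rho> n \<noteq> 0 \<and> \<sigma> n \<noteq> 0) sequentially"
      and lims: "(\<lambda>n. s\<^sub>1 (\<rho> n) * s\<^sub>2 (\<sigma> n)) \<longlonglongrightarrow> 0" "(\<lambda>n. s\<^sub>3 (\<rho> n)) \<longlonglongrightarrow> 0" "(\<lambda>n. s\<^sub>4 (\<sigma> n)) \<longlonglongrightarrow> 0"
      and XY: "X \<noteq> 0" "Y \<noteq> 0"
      and ne: "eventually (\<lambda>n. a * (\<rho> n * X) \<noteq> b * (\<sigma> n * Y) \<and> a * (\<rho> n * X) \<noteq> - (b * (\<sigma> n * Y))) sequentially"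
    for \<rho> \<sigma> X Y z
  proof (rule tendsto_sandwich[OF _ _ tendsto_const])
    have "(\<lambda>n. h\<^sub>1 (\<rho> n * X) z * h\<^sub>2 (\<sigma> n * Y) z + h\<^sub>3 (\<rho> n * X) z + h\<^sub>4 (\<sigma> n * Y) z)
        \<longlonglongrightarrow> 0 + 0 + 0"
      using lims nz unfolding s\<^sub>1_def s\<^sub>2_def s\<^sub>3_def s\<^sub>4_def
      by (intro tendsto_add tendsto_dilated_mult_dilated tendsto_dilated h_nonneg)
    then show "(\<lambda>n. h\<^sub>1 (\<rho> n * X) z * h\<^sub>2 (\<sigma> n * Y) z + h\<^sub>3 (\<rho> n * X) z + h\<^sub>4 (\<sigma> n * Y) z) \<longlonglongrightarrow> 0"
      by simp
    show "eventually (\<lambda>n. q (D (\<rho> n * X) (\<sigma> n * Y)) z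
        \<le> h\<^sub>1 (\<rho> n * X) z * h\<^sub>2 (\<sigma> n * Y) z + h\<^sub>3 (\<rho> n * X) z + h\<^sub>4 (\<sigma> n * Y) z) sequentially"
      using nz ne by eventually_elim (rule D_le, use XY in auto)
  qed (simp add: q_nonneg)

  have UV_lim: "(\<lambda>n. q (D (U n * T) (V n * T)) z) \<longlonglongrightarrow> 0" if "T \<noteq> 0" for T z
  proof (rule D_lim)
    show "eventually (\<lambda>n. a * (U n * T) \<noteq> b * (V n * T) \<and> a * (U n * T) \<noteq> - (b * (V n * T))) sequentially"
      using eventually_ge_at_top[of 2]
    proof eventually_elim
      case (elim n)
      \<comment> \<open>The difference and the sum of \<open>a * (U n * T)\<close> and
        \<open>b * (V n * T)\<close> are \<open>W n * T\<close> and \<open>T\<close>, both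
        nonzero.\<close>
      have "real n ^ 3 \<noteq> 1 - real n ^ 3" "real n ^ 3 \<noteq> - (1 - real n ^ 3)"
        using cube_gt_1[OF elim] by linarith+
      then show ?case
        using that by (metis aU bV mult_minus_left mult_right_cancel)
    qed
    show "(\<lambda>n. s\<^sub>1 (U n) * s\<^sub>2 (V n)) \<longlonglongrightarrow> 0" "(\<lambda>n. s\<^sub>3 (U n)) \<longlonglongrightarrow> 0" "(\<lambda>n. s\<^sub>4 (V n)) \<longlonglongrightarrow> 0"
      by (auto intro!: tendsto_0_le_ennreal[OF lim_max] simp: U_def V_def le_max_iff_disj)
  qed (use that ev in \<open>auto elim: eventually_mono\<close>)

  define X Y where "X = x ^ 3" and "Y = y ^ 3"
  have XY: "X \<noteq> 0" "Y \<noteq> 0" "a * X \<noteq> b * Y" "a * X \<noteq> - (b * Y)"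
    using xy by (auto simp: X_def Y_def root3_mult_eq_iff)
  \<comment> \<open>The side conditions are what lets \<open>UV_lim\<close> be used at these two
    points.\<close>
  then have PM: "a * X + b * Y \<noteq> 0" "a * X - b * Y \<noteq> 0"
    by (auto simp: add_eq_0_iff2)

  have diag_lim: "(\<lambda>n. q (D (\<rho> n * X) (\<rho> n * Y)) z) \<longlonglongrightarrow> 0"
    if nz: "eventually (\<lambda>n. \<rho> n \<noteq> 0) sequentially"
      and lims: "(\<lambda>n. s\<^sub>1 (\<rho> n) * s\<^sub>2 (\<rho> n)) \<longlonglongrightarrow> 0" "(\<lambda>n. s\<^sub>3 (\<rho> n)) \<longlonglongrightarrow> 0" "(\<lambda>n. s\<^sub>4 (\<rho> n)) \<longlonglongrightarrow> 0"
    for \<rho> z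
  proof (rule D_lim[OF _ lims])
    show "eventually (\<lambda>n. a * (\<rho> n * X) \<noteq> b * (\<rho> n * Y) \<and> a * (\<rho> n * X) \<noteq> - (b * (\<rho> n * Y))) sequentially"
      using nz
    proof eventually_elim
      case (elim n)
      have "a * (\<rho> n * X) = \<rho> n * (a * X)" "b * (\<rho> n * Y) = \<rho> n * (b * Y)"
        by (rule mult.left_commute)+
      then show ?case
        using elim XY by (metis mult_minus_right mult_left_cancel)
    qed
  qed (use XY nz in auto)

  have D_UV: "D (U n * T) (V n * T) = g T + g (W n * T)
      - smul (of_real c) (g (U n * T)) - smul (of_real d) (g (V n * T))" for n T
  proof -
    have "a * (U n * T) + b * (V n * T) = T" "a * (U n * T) - b * (V n * T) = W n * T"
      unfolding aU bV W by (simp_all add: algebra_simps)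
    then show ?thesis
      by (simp add: D_def)
  qed
  have D_scaled: "D (t * X) (t * Y) = g (t * (a * X + b * Y)) + g (t * (a * X - b * Y))
      - smul (of_real c) (g (t * X)) - smul (of_real d) (g (t * Y))" for t
    by (simp add: D_def algebra_simps)
  define R where "R n = D (U n * (a * X + b * Y)) (V n * (a * X + b * Y))
      + D (U n * (a * X - b * Y)) (V n * (a * X - b * Y))
      - smul (of_real c) (D (U n * X) (V n * X)) - smul (of_real d) (D (U n * Y) (V n * Y))
      + smul (of_real c) (D (U n * X) (U n * Y)) + smul (of_real d) (D (V n * X) (V n * Y))
      - D (W n * X) (W n * Y)" for n
  \<comment> \<open>All values at multiples of \<open>U n\<close>, \<open>V n\<close>,
    \<open>W n\<close> cancel, those with coefficient \<open>c * d\<close> because scalars commute.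
    \<open>D_def\<close> is unfolded last since \<open>D_UV\<close> and \<open>D_scaled\<close>
    match the folded form.\<close>
  have R_eq: "R n = D X Y" for n
    unfolding R_def D_UV D_scaled unfolding D_def
    by (simp add: scale_right_diff_distrib scale_right_distrib scale_left_commute algebra_simps)
  have "(\<lambda>n. q (R n) z) \<longlonglongrightarrow> 0" for z
    unfolding R_def
    by (intro tendsto_q_add tendsto_q_diff tendsto_q_scale UV_lim diag_lim PM XY coeff_lims
        eventually_mono[OF ev]) auto
  \<comment> \<open>The sequence is constant in \<open>n\<close>, so its limit 0 is its value, for
    every \<open>z\<close>.\<close>
  then have "D X Y = 0"
    by (intro eq_0_if_q_eq_0) (simp add: R_eq LIMSEQ_const_iff)
  then show "f (root 3 (a * x ^ 3 + b * y ^ 3)) + f (root 3 (a * x ^ 3 - b * y ^ 3))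
      = smul (of_real c) (f x) + smul (of_real d) (f y)"
    by (simp add: D_def g_def X_def Y_def odd_real_root_power_cancel algebra_simps)
qed

end
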